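(* Let $\ell\equiv 0 \pmod 4$ be a positive integer. If there exists a Hadamard matrix of order $\ell$, then there exists an $\left(\ell^2, \binom{\ell}{2}, \frac{\ell(\ell-2)}{4}\right)$-BIBD admitting a $0$-ULSE $\ell$-colouring.
   Context: A Hadamard matrix of order $n$ is an $n\times n$ matrix with entries in $\{-1,1\}$ whose rows are pairwise orthogonal. For positive integers $v,k,\lambda$ with $2\le k<v$, a $(v,k,\lambda)$-BIBD is a pair $(V,\mathcal{B})$ where $V$ is a set of $v$ points and $\mathcal{B}$ is a collection of $k$-element subsets of $V$ (blocks) such that every pair of distinct points lies in exactly $\lambda$ blocks. An $\ell$-colouring of a BIBD is a surjective map from $V$ onto a set of $\ell$ colours. A $0$-ULSE $\ell$-colouring is an $\ell$-colouring such that $(\ell-1)$ divides $k$ and in every block exactly one colour does not appear, while each of the other $\ell-1$ colours appears exactly $\frac{k}{\ell-1}$ times in that block. *)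

theory Defs
  imports
    "Jordan_Normal_Form.Matrix"
    "HOL-Library.Multiset"
    "HOL-Number_Theory.Cong"
begin

definition hadamard_matrix :: "nat \<Rightarrow> int mat \<Rightarrow> bool" where
  "hadamard_matrix n H \<longleftrightarrow>
     H \<in> carrier_mat n n \<and>
     (\<forall>i<n. \<forall>j<n. H $$ (i, j) \<in> {-1, 1}) \<and>
     (\<forall>i<n. \<forall>j<n. i \<noteq> j \<longrightarrow> row H i \<bullet> row H j = 0)"

text \<open>The blocks form a multiset, so repeated blocks are allowed and are counted with
  multiplicity.\<close>

definition bibd :: "nat \<Rightarrow> nat \<Rightarrow> nat \<Rightarrow> 'a set \<Rightarrow> 'a set multiset \<Rightarrow> bool" where
  "bibd v k lam V \<B> \<longleftrightarrow>
     2 \<le> k \<and> k < v \<and> 0 < lam \<and>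
     finite V \<and> card V = v \<and>
     (\<forall>B\<in>#\<B>. B \<subseteq> V \<and> card B = k) \<and>
     (\<forall>x\<in>V. \<forall>y\<in>V. x \<noteq> y \<longrightarrow> size {#B \<in># \<B>. x \<in> B \<and> y \<in> B#} = lam)"

text \<open>Only the values of the colouring on \<open>V\<close> matter; \<open>C\<close> is the set of colours.\<close>

definition colouring :: "nat \<Rightarrow> 'a set \<Rightarrow> 'c set \<Rightarrow> ('a \<Rightarrow> 'c) \<Rightarrow> bool" where
  "colouring l V C c \<longleftrightarrow> finite C \<and> card C = l \<and> c ` V = C"

text \<open>The divisibility condition makes the quotient \<open>k div (l - 1)\<close> exact.\<close>

definition zero_ULSE_colouring ::
    "nat \<Rightarrow> nat \<Rightarrow> 'a set \<Rightarrow> 'a set multiset \<Rightarrow> 'c set \<Rightarrow> ('a \<Rightarrow> 'c) \<Rightarrow> bool" where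
  "zero_ULSE_colouring l k V \<B> C c \<longleftrightarrow>
     colouring l V C c \<and>
     (l - 1) dvd k \<and>
     (\<forall>B\<in>#\<B>.
        (\<exists>!x. x \<in> C \<and> x \<notin> c ` B) \<and>
        (\<forall>x\<in>C. x \<in> c ` B \<longrightarrow> card {p \<in> B. c p = x} = k div (l - 1)))"

end

theory Submission
  imports Defs "Jordan_Normal_Form.Determinant"
begin

text \<open>Normalise the Hadamard matrix so that its first row is constant, let \<open>r\<^sub>a\<close> denote its rows and
  put \<open>C\<^sub>a = r\<^sub>a\<^sup>T r\<^sub>a\<close>.  Then \<open>C\<^sub>0 = J\<close>, the rows and columns of \<open>C\<^sub>a\<close> sum to zero for \<open>a \<noteq> 0\<close>,
  \<open>C\<^sub>a C\<^sub>b = 0\<close> for \<open>a \<noteq> b\<close>, and the \<open>C\<^sub>a\<^sup>2 = l C\<^sub>a\<close> sum to \<open>l\<^sup>2 I\<close>.  Arranging the \<open>C\<^sub>a\<close> along the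
  cyclic Latin square \<open>a = i - j mod l\<close>, which is zero exactly on the diagonal, gives a Bush-type
  Hadamard matrix of order \<open>l\<^sup>2\<close> with constant line sum \<open>l\<close>.  The positions of \<open>-1\<close> in its rows are
  the blocks, and the colour of a point is its block column: a row misses the colour of its own
  diagonal block \<open>J\<close> and meets every other colour in half of its \<open>l\<close> points.\<close>

section \<open>Counting with signs\<close>

text \<open>The product \<open>(1 - f x) * (1 - g x)\<close> is 4 where both signs are -1 and 0
  elsewhere; its sum is expanded.\<close>

lemma card_both_neg:
  fixes f g :: "'a \<Rightarrow> int"
  assumes "finite S" and "\<And>x. x \<in> S \<Longrightarrow> f x \<in> {-1, 1}" and "\<And>x. x \<in> S \<Longrightarrow> g x \<in> {-1, 1}"
  shows "4 * int (card {x \<in> S. f x = -1 \<and> g x = -1})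
    = int (card S) - sum f S - sum g S + (\<Sum>x\<in>S. f x * g x)"
proof -
  have "(\<Sum>x\<in>S. (1 - f x) * (1 - g x)) = (\<Sum>x\<in>S. if f x = -1 \<and> g x = -1 then 4 else 0)"
    using assms(2,3) by (intro sum.cong) fastforce+
  also have "\<dots> = 4 * int (card {x \<in> S. f x = -1 \<and> g x = -1})"
    using assms(1) by (simp flip: sum.inter_filter)
  finally show ?thesis
    by (simp add: algebra_simps sum.distrib sum_subtractf)
qed

lemma card_neg:
  fixes f :: "'a \<Rightarrow> int"
  assumes "finite S" and "\<And>x. x \<in> S \<Longrightarrow> f x \<in> {-1, 1}"
  shows "2 * int (card {x \<in> S. f x = -1}) = int (card S) - sum f S"
proof -
  have "(\<Sum>x\<in>S. f x * f x) = (\<Sum>x\<in>S. 1)"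
    using assms(2) by (intro sum.cong) fastforce+
  then show ?thesis
    using card_both_neg[of S f f] assms by simp
qed

text \<open>An index below \<open>n ^ 2\<close> encodes a pair: block number \<open>x div n\<close>
  and position \<open>x mod n\<close> inside that block. This lemma and the next two translate
  between both views.\<close>

lemma div_mod_less_square:
  fixes x n :: nat
  assumes "x < n ^ 2" shows "x div n < n" and "x mod n < n"
  using assms by (auto simp: power2_eq_square less_mult_imp_div_less intro!: mod_less_divisor gr0I)

lemma mult_add_less_square:
  fixes i p n :: nat
  assumes "i < n" "p < n" shows "i * n + p < n ^ 2"
proof -
  have "i * n + p < Suc i * n" using assms by simp
  also have "\<dots> \<le> n * n" using assms by (intro mult_right_mono) auto
  finally show ?thesis by (simp add: power2_eq_square)
qed

lemma sum_div_mod: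
  fixes f :: "nat \<Rightarrow> nat \<Rightarrow> 'b::comm_monoid_add"
  shows "(\<Sum>x<n ^ 2. f (x div n) (x mod n)) = (\<Sum>i<n. \<Sum>p<n. f i p)"
proof -
  have "(\<Sum>x<n ^ 2. f (x div n) (x mod n)) = (\<Sum>(i, p)\<in>{..<n} \<times> {..<n}. f i p)"
  proof (rule sum.reindex_bij_witness[where i = "\<lambda>(i, p). i * n + p" and j = "\<lambda>x. (x div n, x mod n)"])
    fix x assume "x \<in> {..<n ^ 2}"
    then show "(x div n, x mod n) \<in> {..<n} \<times> {..<n}"
      by (auto simp: div_mod_less_square)
  qed (auto simp: mult_add_less_square)
  then show ?thesis by (simp add: sum.cartesian_product)
qed

section \<open>Normalised Hadamard matrices\<close>

lemma hadamard_matrix_row_prod: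
  assumes "hadamard_matrix n H" "i < n" "j < n"
  shows "(\<Sum>p<n. H $$ (i, p) * H $$ (j, p)) = (if i = j then int n else 0)"
proof -
  have "row H i \<bullet> row H j = (\<Sum>p<n. H $$ (i, p) * H $$ (j, p))"
    using assms by (auto simp: hadamard_matrix_def scalar_prod_def lessThan_atLeast0 intro!: sum.cong)
  moreover have "(\<Sum>p<n. H $$ (i, p) * H $$ (i, p)) = (\<Sum>p<n. 1)"
    using assms by (intro sum.cong) (fastforce simp: hadamard_matrix_def)+
  ultimately show ?thesis using assms by (auto simp: hadamard_matrix_def)
qed

text \<open>Row orthogonality makes the transpose divided by \<open>n\<close> a right inverse. Over
  the field of rationals it is then also a left inverse, which is column orthogonality.\<close>

lemma hadamard_matrix_col_prod:
  assumes H: "hadamard_matrix n H" and "p < n" "q < n" "p \<noteq> q"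
  shows "(\<Sum>a<n. H $$ (a, p) * H $$ (a, q)) = 0"
proof -
  define A :: "rat mat" where "A = mat n n (\<lambda>(i, j). of_int (H $$ (i, j)))"
  define B :: "rat mat" where "B = mat n n (\<lambda>(i, j). of_int (H $$ (j, i)) / of_nat n)"
  have "A * B = 1\<^sub>m n"
  proof (rule eq_matI)
    fix i j assume ij: "i < dim_row (1\<^sub>m n :: rat mat)" "j < dim_col (1\<^sub>m n :: rat mat)"
    then have "(A * B) $$ (i, j) = of_int (\<Sum>p<n. H $$ (i, p) * H $$ (j, p)) / of_nat n"
      by (simp add: A_def B_def scalar_prod_def lessThan_atLeast0 sum_divide_distrib)
    with ij show "(A * B) $$ (i, j) = 1\<^sub>m n $$ (i, j)"
      by (subst (asm) hadamard_matrix_row_prod[OF H]) auto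
  qed (auto simp: A_def B_def)
  then have BA: "B * A = 1\<^sub>m n"
    by (rule mat_mult_left_right_inverse[rotated 2]) (auto simp: A_def B_def)
  have "(B * A) $$ (p, q) = of_int (\<Sum>a<n. H $$ (a, p) * H $$ (a, q)) / of_nat n"
    using assms by (simp add: A_def B_def scalar_prod_def lessThan_atLeast0 sum_divide_distrib)
  then have "of_int (\<Sum>a<n. H $$ (a, p) * H $$ (a, q)) = (0 :: rat)"
    using assms by (simp add: BA)
  then show ?thesis by linarith
qed

locale normalised_hadamard =
  fixes l :: nat and h :: "nat \<Rightarrow> nat \<Rightarrow> int"
  assumes sign: "a < l \<Longrightarrow> p < l \<Longrightarrow> h a p \<in> {-1, 1}"
    and first_row: "p < l \<Longrightarrow> h 0 p = 1"
    and row_prod: "a < l \<Longrightarrow> b < l \<Longrightarrow> (\<Sum>p<l. h a p * h b p) = (if a = b then int l else 0)"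
    and col_prod: "p < l \<Longrightarrow> q < l \<Longrightarrow> p \<noteq> q \<Longrightarrow> (\<Sum>a<l. h a p * h a q) = 0"

text \<open>Column \<open>p\<close> is multiplied by its own first entry, a sign. Its square 1
  cancels in row products; column products only change by a constant factor.\<close>

lemma normalise_hadamard_matrix:
  assumes H: "hadamard_matrix l H"
  shows "normalised_hadamard l (\<lambda>a p. H $$ (a, p) * H $$ (0, p))"
proof
  have s: "H $$ (a, p) = -1 \<or> H $$ (a, p) = 1" if "a < l" "p < l" for a p
    using H that by (auto simp: hadamard_matrix_def)
  show "H $$ (a, p) * H $$ (0, p) \<in> {-1, 1}" if "a < l" "p < l" for a p
    using s[OF that] s[of 0 p] that by auto
  show sq: "H $$ (0, p) * H $$ (0, p) = 1" if "p < l" for p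
    using s[of 0 p] that by auto
  show "(\<Sum>p<l. H $$ (a, p) * H $$ (0, p) * (H $$ (b, p) * H $$ (0, p)))
      = (if a = b then int l else 0)" if "a < l" "b < l" for a b
  proof -
    have "H $$ (a, p) * H $$ (0, p) * (H $$ (b, p) * H $$ (0, p)) = H $$ (a, p) * H $$ (b, p)"
      if "p < l" for p using s[of 0 p] that by auto
    then show ?thesis
      unfolding hadamard_matrix_row_prod[OF H that, symmetric] by (intro sum.cong) auto
  qed
  show "(\<Sum>a<l. H $$ (a, p) * H $$ (0, p) * (H $$ (a, q) * H $$ (0, q))) = 0"
    if "p < l" "q < l" "p \<noteq> q" for p q
  proof -
    have "(\<Sum>a<l. H $$ (a, p) * H $$ (0, p) * (H $$ (a, q) * H $$ (0, q)))
        = (\<Sum>a<l. H $$ (a, p) * H $$ (a, q)) * (H $$ (0, p) * H $$ (0, q))"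
      unfolding sum_distrib_right by (simp add: mult_ac)
    then show ?thesis using hadamard_matrix_col_prod[OF H that] by simp
  qed
qed

section \<open>The Bush-type matrix\<close>

text \<open>The difference is taken in the integers because subtraction on \<open>nat\<close>
  truncates.\<close>

definition cyclic :: "nat \<Rightarrow> nat \<Rightarrow> nat \<Rightarrow> nat" where
  "cyclic l i j = nat ((int i - int j) mod int l)"

lemma cyclic_less: "i < l \<Longrightarrow> cyclic l i j < l"
  by (simp add: cyclic_def nat_less_iff)

lemma cyclic_same: "cyclic l i i = 0"
  by (simp add: cyclic_def)

lemma cyclic_eq_iff:
  assumes "0 < l"
  shows "cyclic l i j = cyclic l i' j' \<longleftrightarrow> (int i - int j) mod int l = (int i' - int j') mod int l"
  using assms by (simp add: cyclic_def nat_eq_iff)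

lemma cyclic_inject:
  assumes "i < l" "j < l" "i' < l" "j' < l"
  shows "cyclic l i j = cyclic l i j' \<longleftrightarrow> j = j'" and "cyclic l i j = cyclic l i' j \<longleftrightarrow> i = i'"
    and "cyclic l i j = 0 \<longleftrightarrow> i = j"
proof -
  have less: "int l dvd int x - int y \<longleftrightarrow> x = y" if "x < l" "y < l" for x y
    using that by (simp flip: mod_eq_dvd_iff)
  show "cyclic l i j = cyclic l i j' \<longleftrightarrow> j = j'" "cyclic l i j = cyclic l i' j \<longleftrightarrow> i = i'"
    using assms less[of j' j] less[of i i'] by (auto simp: cyclic_eq_iff mod_eq_dvd_iff)
  \<comment> \<open>Zero is itself \<open>cyclic l 0 0\<close>, so this is an instance of the
    equality test.\<close>
  have "cyclic l i j = 0 \<longleftrightarrow> (int i - int j) mod int l = 0"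
    using cyclic_eq_iff[of l i j 0 0] assms by (simp add: cyclic_same)
  then show "cyclic l i j = 0 \<longleftrightarrow> i = j"
    using assms less[of i j] by (simp add: dvd_eq_mod_eq_0)
qed

text \<open>A column of the Latin square is a permutation, being an injective self-map of a finite
  set.\<close>

lemma sum_cyclic: "j < l \<Longrightarrow> (\<Sum>i<l. f (cyclic l i j)) = (\<Sum>a<l. f a)"
proof (rule sum.reindex_bij_betw)
  assume "j < l"
  then have inj: "inj_on (\<lambda>i. cyclic l i j) {..<l}"
    by (auto simp: inj_on_def cyclic_inject)
  moreover have "(\<lambda>i. cyclic l i j) ` {..<l} = {..<l}"
    by (rule endo_inj_surj[OF _ _ inj]) (auto simp: cyclic_less)
  ultimately show "bij_betw (\<lambda>i. cyclic l i j) {..<l} {..<l}"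
    by (simp add: bij_betw_def)
qed

context normalised_hadamard
begin

lemma row_sum: "a < l \<Longrightarrow> (\<Sum>p<l. h a p) = (if a = 0 then int l else 0)"
  using row_prod[of a 0] by (auto simp: first_row)

text \<open>Block \<open>(i, j)\<close> of this matrix is \<open>C\<^sub>a\<close> with
  \<open>a = cyclic l i j\<close>, whose entry at \<open>(p, q)\<close> is
  \<open>h a p * h a q\<close>.\<close>

definition bush :: "nat \<Rightarrow> nat \<Rightarrow> int" where
  "bush y x = (let a = cyclic l (y div l) (x div l) in h a (y mod l) * h a (x mod l))"

lemma bush_sign:
  assumes "y < l ^ 2" "x < l ^ 2" shows "bush y x \<in> {-1, 1}"
proof -
  let ?a = "cyclic l (y div l) (x div l)"
  have "h ?a (y mod l) \<in> {-1, 1}" "h ?a (x mod l) \<in> {-1, 1}"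
    by (intro sign cyclic_less div_mod_less_square assms)+
  then show ?thesis by (auto simp: bush_def Let_def)
qed

text \<open>Factoring out \<open>h a p\<close> leaves the sum of row \<open>a\<close> of
  \<open>h\<close>, which vanishes unless \<open>a = 0\<close>, that is, off the diagonal.\<close>

lemma bush_row_part:
  assumes "i < l" "p < l" "j < l"
  shows "(\<Sum>q<l. h (cyclic l i j) p * h (cyclic l i j) q) = (if i = j then int l else 0)"
  using assms by (simp flip: sum_distrib_left add: row_sum cyclic_less cyclic_inject cyclic_same first_row)

lemma bush_row_sum:
  assumes "y < l ^ 2" shows "(\<Sum>x<l ^ 2. bush y x) = int l"
proof -
  note y = div_mod_less_square[OF assms]
  have "(\<Sum>x<l ^ 2. bush y x) = (\<Sum>j<l. \<Sum>q<l. h (cyclic l (y div l) j) (y mod l) * h (cyclic l (y div l) j) q)"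
    unfolding bush_def Let_def
    by (rule sum_div_mod[where f = "\<lambda>j q. h (cyclic l (y div l) j) (y mod l) * h (cyclic l (y div l) j) q"])
  also have "\<dots> = (\<Sum>j<l. if y div l = j then int l else 0)"
    using y by (intro sum.cong refl bush_row_part) auto
  finally show ?thesis using y by simp
qed

lemma bush_col_sum:
  assumes "x < l ^ 2" shows "(\<Sum>y<l ^ 2. bush y x) = int l"
proof -
  note x = div_mod_less_square[OF assms]
  have "(\<Sum>y<l ^ 2. bush y x) = (\<Sum>i<l. \<Sum>p<l. h (cyclic l i (x div l)) p * h (cyclic l i (x div l)) (x mod l))"
    unfolding bush_def Let_def
    by (rule sum_div_mod[where f = "\<lambda>i p. h (cyclic l i (x div l)) p * h (cyclic l i (x div l)) (x mod l)"])
  \<comment> \<open>Each \<open>C\<^sub>a\<close> is symmetric, so swapping the factors turns a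
    column part into a row part.\<close>
  also have "\<dots> = (\<Sum>i<l. if i = x div l then int l else 0)"
    using x by (intro sum.cong refl, subst mult.commute, intro bush_row_part) auto
  finally show ?thesis using x by simp
qed

text \<open>For distinct block columns, each block row pairs two different rows of \<open>h\<close>,
  and the sum over \<open>p\<close> vanishes. In one block column that sum is \<open>l\<close>, and
  the sum over \<open>i\<close> runs through every row of \<open>h\<close> once, so distinct columns
  of \<open>h\<close> are orthogonal there.\<close>

lemma bush_col_prod:
  assumes "x < l ^ 2" "x' < l ^ 2" "x \<noteq> x'"
  shows "(\<Sum>y<l ^ 2. bush y x * bush y x') = 0"
proof -
  define j q j' q' where "j = x div l" and "q = x mod l" and "j' = x' div l" and "q' = x' mod l"
  have lt: "j < l" "q < l" "j' < l" "q' < l"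
    using div_mod_less_square assms by (auto simp: j_def q_def j'_def q'_def)
  have ne: "j \<noteq> j' \<or> q \<noteq> q'"
    using assms(3) div_mult_mod_eq[of x l] div_mult_mod_eq[of x' l]
    unfolding j_def q_def j'_def q'_def by metis
  let ?f = "\<lambda>i p. h (cyclic l i j) p * h (cyclic l i j) q * (h (cyclic l i j') p * h (cyclic l i j') q')"
  have inner: "(\<Sum>p<l. ?f i p) =
      (if j = j' then int l else 0) * (h (cyclic l i j) q * h (cyclic l i j') q')" if "i < l" for i
  proof -
    have "(\<Sum>p<l. ?f i p) = (\<Sum>p<l. h (cyclic l i j) p * h (cyclic l i j') p)
        * (h (cyclic l i j) q * h (cyclic l i j') q')"
      unfolding sum_distrib_right by (simp add: mult_ac)
    then show ?thesis
      using that lt by (simp add: row_prod cyclic_less cyclic_inject)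
  qed
  have "(\<Sum>y<l ^ 2. bush y x * bush y x') = (\<Sum>i<l. \<Sum>p<l. ?f i p)"
    unfolding bush_def Let_def
    by (fold j_def q_def j'_def q'_def) (rule sum_div_mod[where f = ?f])
  also have "\<dots> = (\<Sum>i<l. (if j = j' then int l else 0) * (h (cyclic l i j) q * h (cyclic l i j') q'))"
    by (intro sum.cong refl inner) auto
  also have "\<dots> = 0"
  proof (cases "j = j'")
    case True
    then have "(\<Sum>i<l. h (cyclic l i j) q * h (cyclic l i j') q') = 0"
      using sum_cyclic[OF lt(1), of "\<lambda>a. h a q * h a q'"] col_prod[OF lt(2,4)] ne by simp
    then show ?thesis by (simp flip: sum_distrib_left)
  qed simp
  finally show ?thesis .
qed

section \<open>Blocks and colour classes\<close>

definition block :: "nat \<Rightarrow> nat set" where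
  "block y = {x \<in> {..<l ^ 2}. bush y x = -1}"

lemma card_block:
  assumes "y < l ^ 2" shows "2 * int (card (block y)) = int l ^ 2 - int l"
  using card_neg[of "{..<l ^ 2}" "bush y"] bush_sign bush_row_sum assms
  by (simp add: block_def)

text \<open>Letting \<open>y\<close> vary in \<open>x \<in> block y\<close> reads off column
  \<open>x\<close> of \<open>bush\<close>, so column sums and column products enter.\<close>

lemma card_blocks_through:
  assumes "x < l ^ 2" "x' < l ^ 2" "x \<noteq> x'"
  shows "4 * int (card {y \<in> {..<l ^ 2}. x \<in> block y \<and> x' \<in> block y}) = int l ^ 2 - 2 * int l"
  using card_both_neg[of "{..<l ^ 2}" "\<lambda>y. bush y x" "\<lambda>y. bush y x'"]
    bush_sign bush_col_sum bush_col_prod assms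
  by (simp add: block_def)

text \<open>These points are the -1 entries in a single row of one \<open>C\<^sub>a\<close>, so its
  row sum determines their number.\<close>

lemma card_block_colour:
  assumes "y < l ^ 2" "j < l"
  shows "2 * int (card {x \<in> block y. x div l = j}) = (if j = y div l then 0 else int l)"
proof -
  note y = div_mod_less_square[OF assms(1)]
  let ?a = "cyclic l (y div l) j"
  let ?g = "\<lambda>q. h ?a (y mod l) * h ?a q"
  have "bij_betw (\<lambda>x. x mod l) {x \<in> block y. x div l = j} {q \<in> {..<l}. ?g q = -1}"
  proof (rule bij_betw_byWitness[where f' = "\<lambda>q. j * l + q"])
    show "(\<lambda>x. x mod l) ` {x \<in> block y. x div l = j} \<subseteq> {q \<in> {..<l}. ?g q = -1}"
      using div_mod_less_square(2) by (fastforce simp: block_def bush_def Let_def)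
    show "(\<lambda>q. j * l + q) ` {q \<in> {..<l}. ?g q = -1} \<subseteq> {x \<in> block y. x div l = j}"
      using mult_add_less_square[OF assms(2)] by (auto simp: block_def bush_def Let_def)
  qed auto
  then have "card {x \<in> block y. x div l = j} = card {q \<in> {..<l}. ?g q = -1}"
    by (rule bij_betw_same_card)
  moreover have "2 * int (card {q \<in> {..<l}. ?g q = -1}) = int l - (\<Sum>q<l. ?g q)"
  proof (subst card_neg)
    fix q assume "q \<in> {..<l}"
    then have "h ?a (y mod l) \<in> {-1, 1}" "h ?a q \<in> {-1, 1}"
      using y by (intro sign cyclic_less; simp)+
    then show "?g q \<in> {-1, 1}" by auto
  qed auto
  ultimately show ?thesis using bush_row_part[OF y assms(2)] by auto
qed

lemma block_colours:
  assumes "y < l ^ 2" "j < l"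
  shows "j \<in> (\<lambda>x. x div l) ` block y \<longleftrightarrow> j \<noteq> y div l"
proof -
  have "finite {x \<in> block y. x div l = j}" by (simp add: block_def)
  then have "j \<in> (\<lambda>x. x div l) ` block y \<longleftrightarrow> card {x \<in> block y. x div l = j} \<noteq> 0"
    by (auto simp: card_eq_0_iff)
  then show ?thesis using card_block_colour[OF assms] assms by (auto split: if_splits)
qed

end

theorem theorem5p3:
  fixes l :: nat
  assumes "0 < l"
    and "[l = 0] (mod 4)"
    and "\<exists>H. hadamard_matrix l H"
  shows "\<exists>(V :: nat set) (\<B> :: nat set multiset) (C :: nat set) (c :: nat \<Rightarrow> nat).
           bibd (l ^ 2) (l choose 2) (l * (l - 2) div 4) V \<B> \<and>
           zero_ULSE_colouring l (l choose 2) V \<B> C c"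
proof -
  obtain H where "hadamard_matrix l H" using assms(3) by blast
  then interpret normalised_hadamard l "\<lambda>a p. H $$ (a, p) * H $$ (0, p)"
    by (rule normalise_hadamard_matrix)
  \<comment> \<open>With \<open>l = 4 * m\<close> the block size is \<open>2 * m * (l - 1)\<close>
    and the index is \<open>m * (l - 2)\<close>, so all divisions are exact. Positivity of
    \<open>m\<close> keeps the natural subtractions from truncating.\<close>
  obtain m where l: "l = 4 * m" and m: "0 < m"
    using assms(1,2) by (auto simp: cong_0_iff)
  have choose: "l choose 2 = (l - 1) * (2 * m)"
    by (simp add: choose_two l mult.commute)
  have int_l: "int l = 4 * int m" "int (l - 1) = 4 * int m - 1" "int (l - 2) = 4 * int m - 2"
    using m by (auto simp: l)
  have lam: "l * (l - 2) div 4 = m * (l - 2)"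
    by (simp add: l)
  \<comment> \<open>One block is taken per row index, so counting blocks with multiplicity is
    counting rows.\<close>
  let ?V = "{..<l ^ 2}" and ?B = "image_mset block (mset_set {..<l ^ 2})"
  have "card (block y) = l choose 2" if "y < l ^ 2" for y
  proof -
    have "int (card (block y)) = (4 * int m - 1) * (2 * int m)"
      using card_block[OF that] by (simp add: int_l power2_eq_square algebra_simps)
    also have "\<dots> = int ((l - 1) * (2 * m))" by (simp only: int_l of_nat_mult of_nat_numeral)
    finally show ?thesis by (simp only: choose of_nat_eq_iff)
  qed
  moreover have "size {#B \<in># ?B. x \<in> B \<and> x' \<in> B#} = l * (l - 2) div 4"
    if "x < l ^ 2" "x' < l ^ 2" "x \<noteq> x'" for x x'
  proof -
    have "int (card {y \<in> {..<l ^ 2}. x \<in> block y \<and> x' \<in> block y}) = int m * (4 * int m - 2)"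
      using card_blocks_through[OF that] by (simp add: int_l power2_eq_square algebra_simps)
    also have "\<dots> = int (m * (l - 2))" by (simp only: int_l of_nat_mult)
    finally show ?thesis by (simp add: lam filter_mset_image_mset del: of_nat_mult)
  qed
  moreover have "2 \<le> l choose 2"
  proof -
    have "1 * 2 \<le> (l - 1) * (2 * m)" using l m by (intro mult_mono) auto
    then show ?thesis by (simp add: choose)
  qed
  moreover have "l choose 2 < l ^ 2"
  proof -
    have "(l - 1) * (2 * m) < l * l" using l m by (intro mult_strict_mono) auto
    then show ?thesis by (simp add: choose power2_eq_square)
  qed
  moreover have "0 < l * (l - 2) div 4" using l m by (simp add: lam)
  ultimately have "bibd (l ^ 2) (l choose 2) (l * (l - 2) div 4) ?V ?B"
    by (auto simp: bibd_def block_def)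
  moreover have "zero_ULSE_colouring l (l choose 2) ?V ?B {..<l} (\<lambda>x. x div l)"
  proof -
    have "(\<lambda>x. x div l) ` ?V = {..<l}"
    proof (intro equalityI subsetI)
      fix j assume "j \<in> {..<l}"
      then show "j \<in> (\<lambda>x. x div l) ` ?V"
        by (intro image_eqI[where x = "j * l"]) (auto simp: power2_eq_square)
    qed (auto simp: div_mod_less_square)
    then have "colouring l ?V {..<l} (\<lambda>x. x div l)" by (simp add: colouring_def)
    moreover have "\<exists>!j. j \<in> {..<l} \<and> j \<notin> (\<lambda>x. x div l) ` block y" if "y < l ^ 2" for y
      using block_colours[OF that] div_mod_less_square[OF that] by (intro ex1I[where a = "y div l"]) auto
    moreover have "card {x \<in> block y. x div l = j} = (l choose 2) div (l - 1)"
      if "y < l ^ 2" "j < l" "j \<in> (\<lambda>x. x div l) ` block y" for y j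
    proof -
      \<comment> \<open>A colour that occurs lies off the diagonal, where it has
        \<open>l / 2 = 2 * m\<close> points.\<close>
      have "card {x \<in> block y. x div l = j} = 2 * m"
        using card_block_colour[OF that(1,2)] block_colours[OF that(1,2)] that(3)
        by (simp add: l)
      moreover have "0 < l - 1" using l m by simp
      ultimately show ?thesis by (simp add: choose)
    qed
    ultimately show ?thesis by (simp add: zero_ULSE_colouring_def choose)
  qed
  ultimately show ?thesis by blast
qed

end
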